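(* Let $0<\alpha<\beta$ and let $[a,b]=[0,1]$ or $[a,b]=[\alpha,\beta]$. Let $(C[a,b],\{A_n\})$ be an approximation scheme such that $(A_n)$ satisfies de La Vallée-Poussin Theorem with $\phi_{\{A_n\}}(n)=m_n$. Let $\{\varepsilon_n\}_{n=0}^{\infty}$ be a non-increasing sequence of positive real numbers converging to zero. Then there exists $f\in C[a,b]$ such that $f$ is real analytic on $(a,b]$ and $E(f,A_n)\geq \varepsilon_n$ for all $n=0,1,2,\dots$.
   Context: $\mathbb{N}=\{0,1,2,\dots\}$. $C[a,b]$ is the space of continuous real-valued functions on $[a,b]$ with the uniform norm $\|\cdot\|$. For $f\in C[a,b]$ and $A\subset C[a,b]$, $E(f,A)=\inf_{g\in A}\|f-g\|$ is the error of best approximation. Approximation scheme: let $(X,\|\cdot\|)$ be a quasi-Banach space and let $\{0\}=A_0\subset A_1\subset\cdots\subset A_n\subset\cdots\subset X$ be an infinite chain of subsets of $X$, where all inclusions are strict. $(X,\{A_n\})$ is an approximation scheme if: (i) there exists a map $K:\mathbb{N}\to\mathbb{N}$ such that $K(n)\geq n$ and $A_n+A_n\subseteq A_{K(n)}$ for all $n\in\mathbb{N}$; (ii) $\lambda A_n\subset A_n$ for all $n\in\mathbb{N}$ and all scalars $\lambda$; (iii) $\bigcup_{n\in\mathbb{N}}A_n$ is dense in $X$. (The sets $A_n$ need not be linear subspaces.) De La Vallée-Poussin property: given an approximation scheme $(C[a,b],\{A_n\})$, we say that $(A_n)$ satisfies de La Vallée-Poussin Theorem with $\phi_{\{A_n\}}(n)=m_n$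 if $\phi_{\{A_n\}}:\mathbb{N}\to\mathbb{N}$, $n\mapsto m_n$, is a function such that for every $n\in\mathbb{N}$, every $f\in C[a,b]$, every real $\varepsilon>0$ and all points $a\leq t_{0}<t_{1}<\cdots<t_{m_n}\leq b$ the following holds: if $f(t_{k})f(t_{k+1})<0$ for all $0\leq k<m_n$ and $\min_{0\leq k\leq m_n}|f(t_{k})|>\varepsilon$, then $E(f,A_n)\geq\varepsilon$. *)

theory Defs
  imports "HOL-Analysis.Analysis"
begin

text \<open>
  \<^term>\<open>cfunspace\<close> consists of functions that are \<^const>\<open>undefined\<close> outside \<open>{a..b}\<close>, so that two
  elements are equal as soon as they agree on \<open>[a, b]\<close>; its metric is the supremum metric.  The vector
  space operations are the pointwise ones restricted to \<open>{a..b}\<close>.  The two lemmas below spell out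
  that points and distances are those of \<open>C[a, b]\<close> with the uniform norm.
\<close>

definition C_interval :: "real \<Rightarrow> real \<Rightarrow> (real \<Rightarrow> real) metric" where
  "C_interval a b = cfunspace (top_of_set {a..b}) euclidean_metric"

lemma mspace_C_interval:
  "mspace (C_interval a b) = {f \<in> extensional {a..b}. continuous_on {a..b} f}"
proof -
  have "bounded (f ` {a..b})" if "continuous_on {a..b} f" for f :: "real \<Rightarrow> real"
    using that by (intro compact_imp_bounded compact_continuous_image) auto
  then have "Metric_space.mbounded UNIV dist (f ` {a..b})"
    if "continuous_on {a..b} f" for f :: "real \<Rightarrow> real"
    using that by simp
  then show ?thesis
    by (auto simp: C_interval_def)
qed

lemma mdist_C_interval:
  assumes "a \<le> b" "f \<in> mspace (C_interval a b)" "g \<in> mspace (C_interval a b)"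
  shows "mdist (C_interval a b) f g = (SUP x\<in>{a..b}. \<bar>f x - g x\<bar>)"
proof -
  let ?X = "top_of_set {a..b}"
  have m: "f \<in> mspace (funspace {a..b} euclidean_metric)" "g \<in> mspace (funspace {a..b} euclidean_metric)"
    using assms cfunspace_subset_funspace[of ?X euclidean_metric] by (auto simp: C_interval_def)
  then show ?thesis
    using assms(1)
    by (simp add: C_interval_def mdist_cfunspace_eq_mdist_funspace Met_TC.fdist_def flip: dist_real_def)
qed

definition best_approx_error :: "real \<Rightarrow> real \<Rightarrow> (real \<Rightarrow> real) \<Rightarrow> (real \<Rightarrow> real) set \<Rightarrow> real" where
  "best_approx_error a b f A = (INF g\<in>A. mdist (C_interval a b) f g)"

definition approximation_scheme :: "real \<Rightarrow> real \<Rightarrow> (nat \<Rightarrow> (real \<Rightarrow> real) set) \<Rightarrow> bool" where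
  "approximation_scheme a b A \<longleftrightarrow>
     A 0 = {\<lambda>x\<in>{a..b}. 0} \<and>
     (\<forall>n. A n \<subset> A (Suc n)) \<and>
     (\<forall>n. A n \<subseteq> mspace (C_interval a b)) \<and>
     (\<exists>K :: nat \<Rightarrow> nat. \<forall>n. n \<le> K n \<and> (\<forall>f\<in>A n. \<forall>g\<in>A n. (\<lambda>x\<in>{a..b}. f x + g x) \<in> A (K n))) \<and>
     (\<forall>n. \<forall>c::real. \<forall>f\<in>A n. (\<lambda>x\<in>{a..b}. c * f x) \<in> A n) \<and>
     mtopology_of (C_interval a b) closure_of (\<Union>n. A n) = mspace (C_interval a b)"

definition de_la_Vallee_Poussin ::
  "real \<Rightarrow> real \<Rightarrow> (nat \<Rightarrow> (real \<Rightarrow> real) set) \<Rightarrow> (nat \<Rightarrow> nat) \<Rightarrow> bool" where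
  "de_la_Vallee_Poussin a b A m \<longleftrightarrow>
     (\<forall>n. \<forall>f \<in> mspace (C_interval a b). \<forall>\<epsilon>>0. \<forall>t :: nat \<Rightarrow> real.
        a \<le> t 0 \<longrightarrow> t (m n) \<le> b \<longrightarrow> (\<forall>k < m n. t k < t (Suc k)) \<longrightarrow>
        (\<forall>k < m n. f (t k) * f (t (Suc k)) < 0) \<longrightarrow>
        (MIN k \<in> {..m n}. \<bar>f (t k)\<bar>) > \<epsilon> \<longrightarrow>
        best_approx_error a b f (A n) \<ge> \<epsilon>)"

text \<open>
  For \<open>S\<close> an interval that is not open, at an endpoint belonging to \<open>S\<close> the function has to coincide
  on one side with a power series of positive radius of convergence, i.e. it has a real analytic
  extension to a neighbourhood of that endpoint.
\<close>

definition real_analytic_on :: "(real \<Rightarrow> real) \<Rightarrow> real set \<Rightarrow> bool" where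
  "real_analytic_on f S \<longleftrightarrow>
     (\<forall>x\<in>S. \<exists>F :: real fps. fps_conv_radius F > 0 \<and>
        (\<exists>r>0. \<forall>y\<in>S. \<bar>y - x\<bar> < r \<longrightarrow> f y = eval_fps F (y - x)))"

end

theory Submission
  imports Defs "HOL-Complex_Analysis.Complex_Analysis"
begin

text \<open>
  With \<open>y = x - a\<close>, take \<open>f(x) = 3 G(y) sin (1/y)\<close>.  The sine attains \<open>\<plusminus>1\<close> with alternating
  signs at the points \<open>y = 1 / (\<pi>/2 + \<pi> k)\<close>, so for every \<open>n\<close> there is \<open>\<eta>\<^sub>n > 0\<close> such that
  \<open>m\<^sub>n + 1\<close> consecutive ones lie in \<open>[\<eta>\<^sub>n, b - a]\<close>.  The amplitude
  \<open>G(y) = \<Sum>\<^sub>k (\<epsilon>\<^sub>k - \<epsilon>\<^bsub>k+1\<^esub>) y / (y + \<eta>\<^sub>k)\<close> tends to \<open>0\<close> at \<open>0\<close> and extends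
  holomorphically to \<open>Re z > 0\<close>, because there \<open>|z / (z + \<eta>\<^sub>k)| \<le> 1\<close>.  For \<open>y \<ge> \<eta>\<^sub>n\<close> the
  terms with \<open>k \<ge> n\<close> have a factor \<open>y / (y + \<eta>\<^sub>k) \<ge> 1/2\<close>, so they telescope to at least
  \<open>\<epsilon>\<^sub>n / 2\<close>, and the de La Vall'ee-Poussin property applies to \<open>f\<close>.
\<close>

text \<open>Expand \<open>F\<close> in its Taylor series at the real point \<open>x\<close>. For
  real \<open>y\<close> the powers of \<open>y - x\<close> are real, so taking real parts of the
  coefficients yields a real power series for \<open>f\<close>.\<close>

lemma real_analytic_on_Re_holomorphic:
  assumes "F holomorphic_on U" and "open U" and "\<And>x. x \<in> S \<Longrightarrow> complex_of_real x \<in> U"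
    and "\<And>x. x \<in> S \<Longrightarrow> f x = Re (F (of_real x))"
  shows "real_analytic_on f S"
  unfolding real_analytic_on_def
proof
  fix x assume "x \<in> S"
  with assms obtain r where r: "r > 0" "cball (complex_of_real x) r \<subseteq> U"
    by (meson open_contains_cball)
  let ?c = "\<lambda>n. (deriv ^^ n) F (of_real x) / fact n"
  define P where "P = Abs_fps (\<lambda>n. Re (?c n))"
  have hol: "F holomorphic_on ball (of_real x) r"
    using assms(1) r(2) by (meson ball_subset_cball holomorphic_on_subset order_trans)
  have P: "(\<lambda>n. fps_nth P n * (y - x) ^ n) sums Re (F (of_real y))" if "\<bar>y - x\<bar> < r" for y
  proof -
    have "complex_of_real y \<in> ball (of_real x) r"
      using that by (simp add: dist_of_real dist_real_def abs_minus_commute)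
    from holomorphic_power_series[OF hol this]
    have "(\<lambda>n. ?c n * of_real ((y - x) ^ n)) sums F (of_real y)" by simp
    from sums_Re[OF this] show ?thesis
      by (simp only: P_def fps_nth_Abs_fps times_complex.sel Re_complex_of_real Im_complex_of_real
          mult_zero_right diff_zero)
  qed
  \<comment> \<open>Convergence at the single point \<open>x + r / 2\<close> already bounds the
    radius of convergence below by \<open>r / 2\<close>.\<close>
  have "summable (\<lambda>n. fps_nth P n * (r / 2) ^ n)"
    using P[of "x + r / 2"] r(1) by (auto simp: sums_iff)
  from conv_radius_geI[OF this] have "fps_conv_radius P \<ge> ereal (r / 2)"
    using r(1) by (simp add: fps_conv_radius_def)
  moreover have "ereal (r / 2) > 0" using r(1) by simp
  ultimately have "fps_conv_radius P > 0" by (rule less_le_trans[rotated])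
  moreover have "f y = eval_fps P (y - x)" if "y \<in> S" "\<bar>y - x\<bar> < r" for y
    using P[OF that(2)] assms(4)[OF that(1)] by (simp add: eval_fps_def sums_iff)
  ultimately show "\<exists>P. fps_conv_radius P > 0 \<and>
      (\<exists>r>0. \<forall>y\<in>S. \<bar>y - x\<bar> < r \<longrightarrow> f y = eval_fps P (y - x))"
    using r(1) by blast
qed

lemma norm_divide_add_of_real_le_1:
  fixes z :: complex
  assumes "0 \<le> Re z" and "0 < e"
  shows "norm (z / (z + of_real e)) \<le> 1"
proof -
  have "norm z \<le> norm (z + of_real e)"
    using assms by (simp add: cmod_def power_mono)
  then show ?thesis by (simp add: norm_divide divide_le_eq_1)
qed

text \<open>This supplies the amplitude: however fast \<open>\<eta>\<close> decreases,
  \<open>G\<close> can vanish continuously at 0 and still dominate \<open>e n / 2\<close> from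
  \<open>\<eta> n\<close> onwards. \<open>H\<close> carries the analyticity of
  \<open>G\<close>.\<close>

lemma ex_slowly_decaying_holomorphic:
  fixes e \<eta> :: "nat \<Rightarrow> real"
  assumes "decseq e" and "e \<longlonglongrightarrow> 0" and "decseq \<eta>" and "\<And>n. 0 < \<eta> n"
  obtains G H where "H holomorphic_on {z. 0 < Re z}"
    and "\<And>y. 0 \<le> y \<Longrightarrow> H (complex_of_real y) = of_real (G y)"
    and "continuous_on {0..} G" and "G 0 = 0"
    and "\<And>n y. \<eta> n \<le> y \<Longrightarrow> e n / 2 \<le> G y"
proof -
  define c where "c n = e n - e (Suc n)" for n
  have c0: "0 \<le> c n" for n using assms(1) by (simp add: c_def decseq_Suc_iff)
  \<comment> \<open>Telescoping, where the limit 0 of \<open>e\<close> removes the boundary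
    term.\<close>
  have tail: "(\<lambda>k. c (k + n)) sums e n" for n
    using telescope_sums'[of "\<lambda>k. e (k + n)" 0] LIMSEQ_ignore_initial_segment[OF assms(2)]
    by (simp add: c_def)
  have c_summable: "summable c" using tail[of 0] by (simp add: sums_iff)
  define G where "G y = (\<Sum>k. c k * (y / (y + \<eta> k)))" for y
  define H where "H z = (\<Sum>k. of_real (c k) * (z / (z + of_real (\<eta> k))))" for z :: complex
  have bound: "norm (of_real (c k) * (z / (z + of_real (\<eta> k)))) \<le> c k"
    if "0 \<le> Re z" for z :: complex and k
    using mult_left_mono[OF norm_divide_add_of_real_le_1[OF that assms(4)[of k]] c0[of k]] c0[of k]
    by (simp only: norm_mult norm_of_real abs_of_nonneg mult_1_right)
  have boundR: "norm (c k * (y / (y + \<eta> k))) \<le> c k" if "0 \<le> y" for y k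
  proof -
    have "\<bar>y / (y + \<eta> k)\<bar> \<le> 1" using that assms(4)[of k] by (simp add: divide_le_eq_1)
    from mult_left_mono[OF this c0[of k]] show ?thesis using c0[of k] by (simp add: abs_mult)
  qed
  have G_summable: "summable (\<lambda>k. c k * (y / (y + \<eta> k)))" if "0 \<le> y" for y
    using boundR[OF that] by (intro summable_comparison_test'[OF c_summable, of 0]) auto
  \<comment> \<open>The summable majorant \<open>c\<close> is independent of the argument. The
    complex limit gives holomorphy of \<open>H\<close>; the real one includes the endpoint 0 and so
    gives continuity of \<open>G\<close> there.\<close>
  have unif: "uniform_limit {z. 0 \<le> Re z} (\<lambda>n z. \<Sum>k<n. of_real (c k) * (z / (z + of_real (\<eta> k)))) H sequentially"
    unfolding H_def by (rule Weierstrass_m_test[OF _ c_summable]) (use bound in blast)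
  have unifR: "uniform_limit {0..} (\<lambda>n y. \<Sum>k<n. c k * (y / (y + \<eta> k))) G sequentially"
    unfolding G_def by (rule Weierstrass_m_test[OF _ c_summable]) (use boundR in auto)
  show thesis
  proof
    show "H holomorphic_on {z. 0 < Re z}"
    proof (rule holomorphic_uniform_sequence)
      show op: "open {z. 0 < Re z}" by (rule open_halfspace_Re_gt)
      show "(\<lambda>z. \<Sum>k<n. of_real (c k) * (z / (z + of_real (\<eta> k)))) holomorphic_on {z. 0 < Re z}" for n
      proof (intro holomorphic_intros)
        fix k z assume "z \<in> {z. 0 < Re z}"
        then have "0 < Re (z + of_real (\<eta> k))" using assms(4)[of k] by simp
        then show "z + of_real (\<eta> k) \<noteq> 0" by (simp add: complex_eq_iff)
      qed
      fix z assume "z \<in> {z. 0 < Re z}"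
      with op obtain d where d: "d > 0" "cball z d \<subseteq> {z. 0 < Re z}"
        by (meson open_contains_cball)
      from d(2) have "cball z d \<subseteq> {z. 0 \<le> Re z}" by (auto dest!: subsetD)
      from uniform_limit_on_subset[OF unif this] d
      show "\<exists>d>0. cball z d \<subseteq> {z. 0 < Re z} \<and> uniform_limit (cball z d)
          (\<lambda>n z. \<Sum>k<n. of_real (c k) * (z / (z + of_real (\<eta> k)))) H sequentially"
        by (intro exI[of _ d] conjI)
    qed
    show "H (complex_of_real y) = of_real (G y)" if "0 \<le> y" for y
      using suminf_of_real[OF G_summable[OF that], where 'a = complex] by (simp add: H_def G_def)
    show "continuous_on {0..} G"
    proof (rule uniform_limit_theorem[OF _ unifR])
      have "y + \<eta> k \<noteq> 0" if "0 \<le> y" for y k using that assms(4)[of k] by linarith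
      then show "\<forall>\<^sub>F n in sequentially. continuous_on {0..} (\<lambda>y. \<Sum>k<n. c k * (y / (y + \<eta> k)))"
        by (intro always_eventually allI continuous_intros) auto
    qed simp
    show "G 0 = 0" by (simp add: G_def)
    show "e n / 2 \<le> G y" if y: "\<eta> n \<le> y" for n y
    proof -
      have y0: "0 < y" using y assms(4)[of n] by linarith
      \<comment> \<open>Monotonicity gives \<open>\<eta> (k + n) \<le> \<eta> n \<le> y\<close>, so
        the denominator is at most \<open>2 * y\<close>.\<close>
      have half: "1 / 2 \<le> y / (y + \<eta> (k + n))" for k
      proof -
        have "\<eta> (k + n) \<le> y" using decseqD[OF assms(3), of n "k + n"] y by simp
        then show ?thesis using y0 assms(4)[of "k + n"] by (simp add: field_simps)
      qed
      have "summable (\<lambda>k. c (k + n) * (y / (y + \<eta> (k + n))))"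
        by (rule summable_ignore_initial_segment[OF G_summable]) (use y0 in simp)
      from sums_le[OF mult_left_mono[OF half c0] sums_mult2[OF tail] summable_sums[OF this]]
      have "e n * (1 / 2) \<le> (\<Sum>k. c (k + n) * (y / (y + \<eta> (k + n))))" .
      \<comment> \<open>The first \<open>n\<close> terms are nonnegative, so restoring them only
        increases the sum.\<close>
      also have "\<dots> \<le> (\<Sum>k. c (k + n) * (y / (y + \<eta> (k + n)))) + (\<Sum>k<n. c k * (y / (y + \<eta> k)))"
        using y0 c0 assms(4) by (simp add: sum_nonneg less_imp_le add_pos_pos)
      also have "\<dots> = G y"
        unfolding G_def using suminf_split_initial_segment[OF G_summable, of y n] y0 by simp
      finally show ?thesis by simp
    qed
  qed
qed

text \<open>The sine oscillates at 0 but is bounded by 1, so \<open>G\<close> tending to 0 squeezes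
  the product. The value at 0 is 0 because \<open>G 0 = 0\<close>, whatever \<open>1 / 0\<close>
  denotes.\<close>

lemma continuous_on_mult_sin_inverse:
  fixes G :: "real \<Rightarrow> real"
  assumes "continuous_on {0..} G" and "G 0 = 0"
  shows "continuous_on {0..} (\<lambda>y. G y * sin (1 / y))"
  unfolding continuous_on_def
proof
  fix y :: real assume y: "y \<in> {0..}"
  have G: "(G \<longlongrightarrow> G y) (at y within {0..})" using assms(1) y by (auto simp: continuous_on_def)
  show "((\<lambda>y. G y * sin (1 / y)) \<longlongrightarrow> G y * sin (1 / y)) (at y within {0..})"
  proof (cases "y = 0")
    case True
    have "((\<lambda>y. G y * sin (1 / y)) \<longlongrightarrow> 0) (at y within {0..})"
    proof (rule Lim_null_comparison)
      show "\<forall>\<^sub>F y in at y within {0..}. norm (G y * sin (1 / y)) \<le> \<bar>G y\<bar>"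
        by (intro always_eventually) (simp add: abs_mult mult_left_le)
      show "((\<lambda>y. \<bar>G y\<bar>) \<longlongrightarrow> 0) (at y within {0..})"
        using tendsto_rabs[OF G] True assms(2) by simp
    qed
    then show ?thesis using True assms(2) by simp
  next
    case False
    then show ?thesis by (intro tendsto_intros G) auto
  qed
qed

theorem theorem2p4:
  fixes \<alpha> \<beta> a b :: real
    and A :: "nat \<Rightarrow> (real \<Rightarrow> real) set"
    and m :: "nat \<Rightarrow> nat"
    and \<epsilon> :: "nat \<Rightarrow> real"
  assumes "0 < \<alpha>" and "\<alpha> < \<beta>"
    and "(a = 0 \<and> b = 1) \<or> (a = \<alpha> \<and> b = \<beta>)"
    and "approximation_scheme a b A"
    and "de_la_Vallee_Poussin a b A m"
    and "decseq \<epsilon>" and "\<And>n. 0 < \<epsilon> n" and "\<epsilon> \<longlonglongrightarrow> 0"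
  shows "\<exists>f \<in> mspace (C_interval a b).
           real_analytic_on f {a<..b} \<and> (\<forall>n. best_approx_error a b f (A n) \<ge> \<epsilon> n)"
proof -
  have ab: "a < b" using assms(1-3) by auto
  define p where "p k = 1 / (pi / 2 + pi * real k)" for k
  have den: "0 < pi / 2 + pi * real k" for k using pi_gt_zero by (simp add: add_pos_nonneg)
  have p_pos: "0 < p k" for k using den by (simp add: p_def)
  have p_less: "p k < p j" if "j < k" for j k
    unfolding p_def using that den[of j] by (intro divide_strict_left_mono mult_pos_pos den) auto
  have p_le: "p k \<le> p j" if "j \<le> k" for j k
    using p_less[of j k] that by (cases "j = k") auto
  have sin_p: "sin (1 / p k) = (-1) ^ k" for k
    by (simp add: p_def sin_add mult.commute[of pi])
  have "p \<longlonglongrightarrow> 0" unfolding p_def by real_asymp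
  then have "\<forall>\<^sub>F k in sequentially. p k < b - a"
    using ab by (simp add: order_tendstoD(2))
  then obtain N where N: "p N < b - a" by (auto simp: eventually_sequentially)
  \<comment> \<open>Since \<open>m\<close> may fail to be monotone, the partial sum is used: it
    makes \<open>\<eta>\<close> decreasing, and it is at least \<open>m n\<close>, so
    \<open>p N, ..., p (N + m n)\<close> are all at least \<open>\<eta> n\<close>.\<close>
  define \<eta> where "\<eta> n = p (N + (\<Sum>i\<le>n. m i))" for n
  have "decseq \<eta>" unfolding \<eta>_def decseq_def by (auto intro!: p_le sum_mono2)
  from ex_slowly_decaying_holomorphic[OF assms(6,8) this] p_pos
  obtain G H where H: "H holomorphic_on {z. 0 < Re z}"
    and HG: "\<And>y. 0 \<le> y \<Longrightarrow> H (complex_of_real y) = of_real (G y)"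
    and contG: "continuous_on {0..} G" and G0: "G 0 = 0"
    and G_ge: "\<And>n y. \<eta> n \<le> y \<Longrightarrow> \<epsilon> n / 2 \<le> G y"
    unfolding \<eta>_def by metis
  \<comment> \<open>With \<open>G\<close> at least \<open>\<epsilon> n / 2\<close>, the factor 3
    gives peaks of height at least \<open>3 / 2 * \<epsilon> n\<close>, hence strictly above
    \<open>\<epsilon> n\<close> as the de La Vallee-Poussin property demands.\<close>
  define f where "f = (\<lambda>x\<in>{a..b}. 3 * (G (x - a) * sin (1 / (x - a))))"
  have f_cont: "continuous_on {a..b} f"
  proof -
    have "continuous_on {a..b} (\<lambda>x. G (x - a) * sin (1 / (x - a)))"
      by (rule continuous_on_compose2[OF continuous_on_mult_sin_inverse[OF contG G0]])
        (auto intro!: continuous_intros)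
    then have "continuous_on {a..b} (\<lambda>x. 3 * (G (x - a) * sin (1 / (x - a))))"
      by (rule continuous_on_mult_left)
    then show ?thesis by (rule continuous_on_eq) (simp add: f_def)
  qed
  then have f_space: "f \<in> mspace (C_interval a b)"
    by (simp add: mspace_C_interval f_def)
  have "real_analytic_on f {a<..b}"
  proof (rule real_analytic_on_Re_holomorphic)
    \<comment> \<open>On this half-plane \<open>z - a\<close> stays in the domain of
      \<open>H\<close> and avoids the essential singularity of \<open>sin (1 / (z - a))\<close> at
      \<open>a\<close>.\<close>
    let ?U = "{z. a < Re z}"
    show "open ?U" by (rule open_halfspace_Re_gt)
    have "(\<lambda>z. H (z - of_real a)) holomorphic_on ?U"
      by (rule holomorphic_on_compose_gen[OF _ H, unfolded o_def]) (auto intro!: holomorphic_intros)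
    then show "(\<lambda>z. 3 * (H (z - of_real a) * sin (1 / (z - of_real a)))) holomorphic_on ?U"
      by (intro holomorphic_intros) auto
    fix x assume x: "x \<in> {a<..b}"
    then show "complex_of_real x \<in> ?U" by simp
    have "3 * (H (of_real x - of_real a) * sin (1 / (of_real x - of_real a)))
        = complex_of_real (3 * (G (x - a) * sin (1 / (x - a))))"
      using HG[of "x - a"] x by (simp flip: sin_of_real)
    then show "f x = Re (3 * (H (of_real x - of_real a) * sin (1 / (of_real x - of_real a))))"
      using x by (simp only: Re_complex_of_real) (simp add: f_def)
  qed
  moreover have "best_approx_error a b f (A n) \<ge> \<epsilon> n" for n
  proof -
    \<comment> \<open>\<open>p\<close> is decreasing, so its indices are run backwards from
      \<open>N + m n\<close> to \<open>N\<close> to make \<open>t\<close> increasing. For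
      \<open>k \<le> m n\<close> the subtraction on naturals does not truncate.\<close>
    define q where "q k = N + m n - k" for k
    define t where "t k = a + p (q k)" for k
    have q_le: "q k \<le> N + (\<Sum>i\<le>n. m i)" for k
      using member_le_sum[of n "{..n}" m] by (simp add: q_def)
    have ft: "f (t k) = 3 * (G (p (q k)) * (-1) ^ q k)" and G_pos: "\<epsilon> n / 2 \<le> G (p (q k))"
      if "k \<le> m n" for k
    proof -
      have "p (q k) \<le> p N" using that by (intro p_le) (simp add: q_def)
      then have "t k \<in> {a..b}" using N p_pos[of "q k"] by (simp add: t_def)
      then show "f (t k) = 3 * (G (p (q k)) * (-1) ^ q k)"
        by (simp add: f_def t_def sin_p)
      show "\<epsilon> n / 2 \<le> G (p (q k))"
        by (rule G_ge) (simp add: \<eta>_def p_le q_le)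
    qed
    show ?thesis
    proof (rule assms(5)[unfolded de_la_Vallee_Poussin_def, rule_format, OF f_space])
      show "0 < \<epsilon> n" by (rule assms(7))
      show "a \<le> t 0" "t (m n) \<le> b"
        using p_pos[of "q 0"] N by (simp_all add: t_def q_def)
      fix k assume k: "k < m n"
      have q_Suc: "q k = Suc (q (Suc k))" using k by (simp add: q_def)
      then show "t k < t (Suc k)" by (simp add: t_def p_less)
      have "0 < G (p (q k)) * G (p (q (Suc k)))"
        using G_pos[of k] G_pos[of "Suc k"] k assms(7)[of n] by (intro mult_pos_pos) auto
      \<comment> \<open>The exponents \<open>q k\<close> and \<open>q (Suc k)\<close> differ by one,
        so the two signs multiply to -1.\<close>
      moreover have "f (t k) * f (t (Suc k)) = - 9 * (G (p (q k)) * G (p (q (Suc k))))"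
        using ft[of k] ft[of "Suc k"] k q_Suc by (simp add: flip: power_mult_distrib)
      ultimately show "f (t k) * f (t (Suc k)) < 0" by simp
    next
      have "\<epsilon> n < \<bar>f (t k)\<bar>" if "k \<le> m n" for k
        using ft[OF that] G_pos[OF that] assms(7)[of n] by (simp add: abs_mult power_abs)
      then show "\<epsilon> n < (MIN k\<in>{..m n}. \<bar>f (t k)\<bar>)" by simp
    qed
  qed
  ultimately show ?thesis using f_space by blast
qed

end
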